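(* Let $M\in\mathbb{N}$ and consider the function $$\mathcal{P}(z)=\left(\frac{1-\sqrt{1-z^2}}{z}\right)^M .$$ Then $\mathcal{P}$ is the probability generating function of a random variable with values in $\mathbb{N}$. Moreover, if $X$ is an integer-valued random variable with probability generating function $\mathcal{P}$, then $X$ is positive discrete stable in the second sense (with the Chebyshev portlying operator).
   Context: $\mathbb{N}=\{1,2,\dots\}$; generating functions are considered for $z\in(0,1]$. A non-negative integer-valued random variable $X$ is positive discrete stable in the second sense if for every $n\in\mathbb{N}$ there is a constant $p_n>0$ such that $$\sum_{j=1}^{X}\varepsilon_j(p_n)\stackrel{d}{=}\sum_{i=1}^nX_i,$$ where $X_1,X_2,\dots$ are independent copies of $X$ and the $\varepsilon_j(p_n)$ are i.i.d. non-negative integer-valued random variables independent of $X$, with a distribution depending on the parameter $p_n$. Equivalently, $\mathcal{P}(\mathcal{Q}_{p_n}(z))=\mathcal{P}^n(z)$, where $\mathcal{P}(z)=\mathrm{E}z^X$ and $\mathcal{Q}_{p_n}(z)=\mathrm{E}z^{\varepsilon_1(p_n)}$. The Chebyshev portlying operator is the family with $p_n=n$ and $$\mathcal{Q}_n(z)=\frac{1}{T_n(1/z)},\qquad n\in\mathbb{N},$$ where $T_n$ is the Chebyshev polynomial of the first kind ($T_n(\cos\theta)=\cos n\theta$); it is known that $\mathcal{Q}_n$ is the probability generating function of a random variable with values in $\mathbb{N}$. *)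

theory Defs
  imports "HOL-Probability.Probability" "HOL-Computational_Algebra.Polynomial"
begin

text \<open>Generating functions are considered on \<open>(0, 1]\<close> only; for an integer-valued variable
  the power has an integer exponent, and the expectation is required to exist.\<close>

definition has_pgf :: "'a measure \<Rightarrow> ('a \<Rightarrow> int) \<Rightarrow> (real \<Rightarrow> real) \<Rightarrow> bool" where
  "has_pgf M X G \<longleftrightarrow>
     prob_space M \<and> X \<in> measurable M (count_space UNIV) \<and>
     (\<forall>z\<in>{0<..1}. has_bochner_integral M (\<lambda>\<omega>. z powi X \<omega>) (G z))"

text \<open>\<open>p\<close> is the sequence of constants \<open>p\<^sub>n\<close>, and \<open>E q\<close> is the common law of the
  \<open>\<epsilon>\<^sub>j(q)\<close>. The equality in distribution only involves laws, so the independent variables are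
  realised as the coordinates of product measures built from the law of \<open>X\<close> and from
  \<open>E (p n)\<close>: on the left \<open>x\<close> is distributed like \<open>X\<close> and is independent of the i.i.d. sequence
  \<open>e\<close>; on the right \<open>x\<^sub>1, \<dots>, x\<^sub>n\<close> are independent copies of \<open>X\<close>.\<close>

definition positive_discrete_stable2 ::
    "(nat \<Rightarrow> real) \<Rightarrow> (real \<Rightarrow> nat pmf) \<Rightarrow> 'a measure \<Rightarrow> ('a \<Rightarrow> int) \<Rightarrow> bool" where
  "positive_discrete_stable2 p E M X \<longleftrightarrow>
     prob_space M \<and> X \<in> measurable M (count_space UNIV) \<and> (AE \<omega> in M. 0 \<le> X \<omega>) \<and>
     (let L = distr M (count_space UNIV) X in
      \<forall>n\<ge>1. p n > 0 \<and>
        distr (L \<Otimes>\<^sub>M (\<Pi>\<^sub>M j\<in>(UNIV :: nat set). measure_pmf (E (p n)))) (count_space UNIV)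
          (\<lambda>(x, e). int (\<Sum>j=1..nat x. e j)) =
        distr (\<Pi>\<^sub>M i\<in>{1..n}. L) (count_space UNIV) (\<lambda>x. \<Sum>i=1..n. x i))"

fun chebyshev_T :: "nat \<Rightarrow> real poly" where
  "chebyshev_T 0 = 1"
| "chebyshev_T (Suc 0) = [:0, 1:]"
| "chebyshev_T (Suc (Suc n)) = [:0, 2:] * chebyshev_T (Suc n) - chebyshev_T n"

lemma chebyshev_T_cos: "poly (chebyshev_T n) (cos \<theta>) = cos (real n * \<theta>)"
proof (induction n rule: chebyshev_T.induct)
  case (3 n)
  have "cos (real (Suc (Suc n)) * \<theta>) = cos (real (Suc n) * \<theta> + \<theta>)"
    by (simp add: algebra_simps)
  moreover have "cos (real n * \<theta>) = cos (real (Suc n) * \<theta> - \<theta>)"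
    by (simp add: algebra_simps)
  ultimately show ?case
    using 3 by (simp add: cos_add cos_diff)
qed simp_all

definition chebyshev_portlying :: "(nat \<Rightarrow> real) \<Rightarrow> (real \<Rightarrow> nat pmf) \<Rightarrow> bool" where
  "chebyshev_portlying p E \<longleftrightarrow>
     (\<forall>n\<ge>1. p n = real n \<and>
        has_pgf (measure_pmf (E (p n))) int (\<lambda>z. 1 / poly (chebyshev_T n) (1 / z)))"

end

theory Submission imports Defs begin

text \<open>Every \<open>z\<close> in \<open>{0<..1}\<close> is \<open>1 / cosh t\<close> for some \<open>t \<ge> 0\<close>. In this
  coordinate \<open>1 / T\<^sub>n(1/z)\<close> is \<open>1 / cosh (n * t)\<close>, while
  \<open>g z = (1 - sqrt (1 - z\<^sup>2)) / z\<close> is \<open>exp (- t)\<close>. Hence \<open>g (Q\<^sub>n z) = g z ^ n\<close>, and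
  the same functional equation holds for every power \<open>P = g ^ m\<close>
  (\<open>first_passage_pgf_chebyshev\<close>). The left side \<open>P (Q\<^sub>n z)\<close> is the generating function
  of the random sum in the definition of stability (\<open>has_pgf_random_sum\<close>), the right side
  \<open>P z ^ n\<close> that of the sum of \<open>n\<close> independent copies (\<open>has_pgf_iid_sum\<close>), and the
  two laws agree because a generating function bounded by \<open>1\<close> on \<open>{0<..1}\<close> determines the law
  of an integer-valued variable (\<open>distr_eq_of_has_pgf\<close>). That bound also forces the variable
  to be nonnegative almost surely (\<open>has_pgf_le_1_imp_nonneg\<close>).

  Two functions have to be recognised as generating functions. For \<open>1 / T\<^sub>n(1/z)\<close> this comes
  from the three-term recurrence: it expresses the ratio of consecutive Chebyshev values as a
  geometric compound of the preceding ratio, and \<open>1 / T\<^sub>n\<close> is a product of such ratios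
  (\<open>has_pgf_chebyshev\<close>). For \<open>g\<close> it comes from the binomial series of the square root, whose
  coefficients are nonnegative after the constant term is removed; powers of \<open>g\<close> are then
  generating functions of sums (\<open>has_pgf_first_passage\<close>, \<open>has_pgf_power\<close>).

  Both families are hitting times of the simple random walk: \<open>g\<close> belongs to the first hitting
  time of level \<open>1\<close>, and \<open>1 / T\<^sub>n(1/z)\<close> for \<open>n \<ge> 1\<close> to the first exit
  time from \<open>(-n, n)\<close>, both for the walk started at \<open>0\<close>.\<close>

section \<open>Calculus of probability generating functions\<close>

text \<open>The integrands \<open>z powi X\<close> are positive, so the existence of a finite expectation is the same
  as a statement about nonnegative integrals. These need no integrability side conditions, which
  is why expectations are computed in this form below.\<close>

lemma has_pgf_iff_nn_integral:
  "has_pgf M X G \<longleftrightarrow>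
     prob_space M \<and> X \<in> measurable M (count_space UNIV) \<and>
     (\<forall>z\<in>{0<..1}. 0 \<le> G z \<and> (\<integral>\<^sup>+\<omega>. ennreal (z powi X \<omega>) \<partial>M) = ennreal (G z))"
proof -
  have "has_bochner_integral M (\<lambda>\<omega>. z powi X \<omega>) (G z) \<longleftrightarrow>
     0 \<le> G z \<and> (\<integral>\<^sup>+\<omega>. ennreal (z powi X \<omega>) \<partial>M) = ennreal (G z)"
    if X: "X \<in> measurable M (count_space UNIV)" and z: "z \<in> {0<..1}" for z
  proof -
    have m: "(\<lambda>\<omega>. z powi X \<omega>) \<in> borel_measurable M"
      using X by (rule measurable_compose) simp
    show ?thesis
    proof (intro iffI conjI)
      assume h: "has_bochner_integral M (\<lambda>\<omega>. z powi X \<omega>) (G z)"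
      then have i: "integrable M (\<lambda>\<omega>. z powi X \<omega>)" and e: "(\<integral>\<omega>. z powi X \<omega> \<partial>M) = G z"
        by (auto simp: has_bochner_integral_iff)
      show "0 \<le> G z"
        unfolding e[symmetric] using z by (intro integral_nonneg_AE) auto
      show "(\<integral>\<^sup>+\<omega>. ennreal (z powi X \<omega>) \<partial>M) = ennreal (G z)"
        unfolding e[symmetric] using z i by (intro nn_integral_eq_integral) auto
    next
      assume "0 \<le> G z \<and> (\<integral>\<^sup>+\<omega>. ennreal (z powi X \<omega>) \<partial>M) = ennreal (G z)"
      then show "has_bochner_integral M (\<lambda>\<omega>. z powi X \<omega>) (G z)"
        using m z by (intro has_bochner_integral_nn_integral) auto
    qed
  qed
  then show ?thesis unfolding has_pgf_def by blast
qed

lemma has_pgf_pmf_iff: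
  "has_pgf (measure_pmf p) int G \<longleftrightarrow>
     (\<forall>z\<in>{0<..1}. 0 \<le> G z \<and> (\<integral>\<^sup>+k. ennreal (z ^ k) \<partial>measure_pmf p) = ennreal (G z))"
  by (simp add: has_pgf_iff_nn_integral measure_pmf.prob_space_axioms)

lemma has_pgf_one: "has_pgf (measure_pmf (return_pmf (0::nat))) int (\<lambda>z. 1)"
  by (simp add: has_pgf_pmf_iff)

lemma has_pgf_id: "has_pgf (measure_pmf (return_pmf (1::nat))) int (\<lambda>z. z)"
  by (simp add: has_pgf_pmf_iff)

lemma has_pgf_mult:
  assumes "has_pgf (measure_pmf (p :: nat pmf)) int F" and "has_pgf (measure_pmf (q :: nat pmf)) int G"
  shows "has_pgf (measure_pmf (map_pmf (\<lambda>(i, j). i + j) (pair_pmf p q))) int (\<lambda>z. F z * G z)"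
  unfolding has_pgf_pmf_iff
proof (intro ballI conjI)
  fix z :: real assume z: "z \<in> {0<..1}"
  have F: "0 \<le> F z" "(\<integral>\<^sup>+k. ennreal (z ^ k) \<partial>measure_pmf p) = ennreal (F z)"
    and G: "0 \<le> G z" "(\<integral>\<^sup>+k. ennreal (z ^ k) \<partial>measure_pmf q) = ennreal (G z)"
    using assms z by (auto simp: has_pgf_pmf_iff)
  show "0 \<le> F z * G z" using F G by simp
  have "(\<integral>\<^sup>+k. ennreal (z ^ k) \<partial>measure_pmf (map_pmf (\<lambda>(i, j). i + j) (pair_pmf p q)))
      = (\<integral>\<^sup>+i. \<integral>\<^sup>+j. ennreal (z ^ i) * ennreal (z ^ j) \<partial>measure_pmf q \<partial>measure_pmf p)"
    using z by (simp add: nn_integral_pair_pmf' power_add ennreal_mult)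
  also have "\<dots> = ennreal (F z) * ennreal (G z)"
    by (simp add: nn_integral_cmult nn_integral_multc F G)
  finally show "(\<integral>\<^sup>+k. ennreal (z ^ k) \<partial>measure_pmf (map_pmf (\<lambda>(i, j). i + j) (pair_pmf p q))) = ennreal (F z * G z)"
    using F G by (simp add: ennreal_mult)
qed

lemma has_pgf_power:
  assumes "has_pgf (measure_pmf (p :: nat pmf)) int G"
  shows "\<exists>q :: nat pmf. has_pgf (measure_pmf q) int (\<lambda>z. G z ^ n)"
proof (induction n)
  case 0
  show ?case using has_pgf_one by auto
next
  case (Suc n)
  then show ?case using has_pgf_mult[OF assms] by auto
qed

lemma nn_integral_pmf_sums:
  fixes p :: "nat pmf"
  assumes "\<And>k. 0 \<le> f k" and "(\<lambda>k. pmf p k * f k) sums s"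
  shows "(\<integral>\<^sup>+k. ennreal (f k) \<partial>measure_pmf p) = ennreal s"
proof -
  have "(\<integral>\<^sup>+k. ennreal (f k) \<partial>measure_pmf p) = (\<Sum>k. ennreal (pmf p k * f k))"
    using assms(1) by (simp add: nn_integral_measure_pmf nn_integral_count_space_nat ennreal_mult)
  also have "\<dots> = ennreal s"
    using assms by (intro suminf_ennreal_eq) auto
  finally show ?thesis .
qed

text \<open>This is the law of a sum of a geometric number of independent variables with generating
  function \<open>z * G z\<close>, plus one further unit step: its generating function is the geometric
  series \<open>\<Sum>j. (1/2)^(j+1) * z * (z * G z)^j\<close>. It is exactly the shape produced by the
  three-term recurrence of the Chebyshev polynomials.\<close>

lemma has_pgf_geometric_compound:
  assumes "has_pgf (measure_pmf (p :: nat pmf)) int G" and "\<And>z. z \<in> {0<..1} \<Longrightarrow> G z \<le> 1"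
  shows "\<exists>q :: nat pmf. has_pgf (measure_pmf q) int (\<lambda>z. (z / 2) / (1 - (z / 2) * G z))"
proof -
  have "\<exists>q :: nat pmf. has_pgf (measure_pmf q) int (\<lambda>z. z * (z * G z) ^ j)" for j
    using has_pgf_power[OF has_pgf_mult[OF has_pgf_id assms(1)], of j] has_pgf_mult[OF has_pgf_id]
    by blast
  then obtain f :: "nat \<Rightarrow> nat pmf"
    where f: "has_pgf (measure_pmf (f j)) int (\<lambda>z. z * (z * G z) ^ j)" for j
    by metis
  have "has_pgf (measure_pmf (bind_pmf (geometric_pmf (1/2)) f)) int
          (\<lambda>z. (z / 2) / (1 - (z / 2) * G z))"
    unfolding has_pgf_pmf_iff
  proof (intro ballI conjI)
    fix z :: real assume z: "z \<in> {0<..1}"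
    have G: "0 \<le> G z" "G z \<le> 1"
      using assms z by (auto simp: has_pgf_pmf_iff)
    have zG: "0 \<le> z * G z" "z * G z \<le> 1"
      using z G by (auto intro: mult_le_one)
    then show "0 \<le> (z / 2) / (1 - (z / 2) * G z)"
      using z by (intro divide_nonneg_nonneg) auto
    have "(\<lambda>j. (z / 2) * ((z / 2) * G z) ^ j) sums ((z / 2) * (1 / (1 - (z / 2) * G z)))"
      using zG by (intro sums_mult geometric_sums) auto
    also have "(\<lambda>j. (z / 2) * ((z / 2) * G z) ^ j)
        = (\<lambda>j. pmf (geometric_pmf (1/2)) j * (z * (z * G z) ^ j))"
      by (simp add: fun_eq_iff power_mult_distrib power_divide)
    finally have s: "(\<lambda>j. pmf (geometric_pmf (1/2)) j * (z * (z * G z) ^ j))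
        sums ((z / 2) / (1 - (z / 2) * G z))"
      by simp
    have "(\<integral>\<^sup>+k. ennreal (z ^ k) \<partial>measure_pmf (bind_pmf (geometric_pmf (1/2)) f))
        = (\<integral>\<^sup>+j. ennreal (z * (z * G z) ^ j) \<partial>measure_pmf (geometric_pmf (1/2)))"
      using f z by (simp add: has_pgf_pmf_iff)
    also have "\<dots> = ennreal ((z / 2) / (1 - (z / 2) * G z))"
      using z G s by (intro nn_integral_pmf_sums) auto
    finally show "(\<integral>\<^sup>+k. ennreal (z ^ k) \<partial>measure_pmf (bind_pmf (geometric_pmf (1/2)) f))
        = ennreal ((z / 2) / (1 - (z / 2) * G z))" .
  qed
  then show ?thesis by blast
qed

section \<open>The Chebyshev operator as a family of generating functions\<close>

text \<open>The hyperbolic form of the defining property is the relevant one here, because the polynomials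
  are evaluated at \<open>1 / z \<ge> 1\<close>.\<close>

lemma chebyshev_T_cosh: "poly (chebyshev_T n) (cosh t) = cosh (real n * t)"
proof (induction n rule: chebyshev_T.induct)
  case (3 n)
  have "cosh (real (Suc (Suc n)) * t) = cosh (real (Suc n) * t + t)"
    by (simp add: algebra_simps)
  moreover have "cosh (real n * t) = cosh (real (Suc n) * t - t)"
    by (simp add: algebra_simps)
  ultimately show ?case
    using 3 by (simp add: cosh_add cosh_diff)
qed simp_all

text \<open>The coordinate \<open>t\<close> linearises the problem: it turns \<open>1 / T\<^sub>n(1/z)\<close> into
  \<open>1 / cosh (n * t)\<close>.\<close>

lemma unit_interval_sech:
  fixes z :: real
  assumes "z \<in> {0<..1}"
  obtains t where "0 \<le> t" and "z = 1 / cosh t"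
proof
  show "0 \<le> arcosh (1 / z)" using assms by simp
  show "z = 1 / cosh (arcosh (1 / z))" using assms by simp
qed

lemma chebyshev_T_inverse_ge_1:
  assumes "z \<in> {0<..1::real}"
  shows "1 \<le> poly (chebyshev_T n) (1 / z)"
proof -
  obtain t where "z = 1 / cosh t" using unit_interval_sech[OF assms] .
  then show ?thesis by (simp add: chebyshev_T_cosh cosh_real_ge_1)
qed

lemma chebyshev_T_ratio_le_1:
  assumes "z \<in> {0<..1::real}"
  shows "poly (chebyshev_T n) (1 / z) / poly (chebyshev_T (Suc n)) (1 / z) \<le> 1"
proof -
  obtain t where "0 \<le> t" "z = 1 / cosh t" using unit_interval_sech[OF assms] .
  then show ?thesis 
    by (auto simp: chebyshev_T_cosh intro!: cosh_real_nonneg_le_iff[THEN iffD2] mult_right_mono)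
qed

text \<open>Dividing \<open>T\<^sub>n\<^sub>+\<^sub>2 = (2/z) * T\<^sub>n\<^sub>+\<^sub>1 - T\<^sub>n\<close> by \<open>T\<^sub>n\<^sub>+\<^sub>1\<close>
  shows that the ratio \<open>r\<^sub>n = T\<^sub>n / T\<^sub>n\<^sub>+\<^sub>1\<close> of the values at \<open>1/z\<close> satisfies
  \<open>r\<^sub>n\<^sub>+\<^sub>1 = (z/2) / (1 - (z/2) * r\<^sub>n)\<close>, so geometric compounding carries the property from
  \<open>n\<close> to \<open>n + 1\<close>. (For a simple random walk on the nonnegative integers that is reflected at
  \<open>0\<close>, \<open>r\<^sub>n\<close> is the generating function of the time it takes to get from \<open>n\<close> to
  \<open>n + 1\<close>.)\<close>

lemma has_pgf_chebyshev_ratio: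
  "\<exists>q :: nat pmf. has_pgf (measure_pmf q) int
     (\<lambda>z. poly (chebyshev_T n) (1 / z) / poly (chebyshev_T (Suc n)) (1 / z))"
proof (induction n)
  case 0
  show ?case using has_pgf_id by auto
next
  case (Suc n)
  then obtain p :: "nat pmf" where p: "has_pgf (measure_pmf p) int
     (\<lambda>z. poly (chebyshev_T n) (1 / z) / poly (chebyshev_T (Suc n)) (1 / z))" by blast
  obtain q :: "nat pmf" where q: "has_pgf (measure_pmf q) int
     (\<lambda>z. (z / 2) / (1 - (z / 2) * (poly (chebyshev_T n) (1 / z) / poly (chebyshev_T (Suc n)) (1 / z))))"
    using has_pgf_geometric_compound[OF p chebyshev_T_ratio_le_1] by blast
  have "(z / 2) / (1 - (z / 2) * (poly (chebyshev_T n) (1 / z) / poly (chebyshev_T (Suc n)) (1 / z)))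
     = poly (chebyshev_T (Suc n)) (1 / z) / poly (chebyshev_T (Suc (Suc n))) (1 / z)"
    if z: "z \<in> {0<..1}" for z
  proof -
    let ?A = "poly (chebyshev_T (Suc n)) (1 / z)" and ?B = "poly (chebyshev_T n) (1 / z)"
    have A: "?A \<ge> 1" "2 / z * ?A - ?B \<ge> 1"
      using chebyshev_T_inverse_ge_1[OF z, of "Suc n"] chebyshev_T_inverse_ge_1[OF z, of "Suc (Suc n)"]
      by auto
    have z0: "z > 0" using z by simp
    have e: "1 - (z / 2) * (?B / ?A) = (z / 2) * (2 / z * ?A - ?B) / ?A"
      using A(1) z0 by (simp add: divide_simps)
    show ?thesis
      unfolding e using A z0 by simp
  qed
  then have "has_pgf (measure_pmf q) int
     (\<lambda>z. poly (chebyshev_T (Suc n)) (1 / z) / poly (chebyshev_T (Suc (Suc n))) (1 / z))"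
    using q by (simp add: has_pgf_def)
  then show ?case by blast
qed

text \<open>The ratios telescope: \<open>1 / T\<^sub>n\<close> is the product of the first \<open>n\<close> of them.\<close>

lemma has_pgf_chebyshev:
  "\<exists>q :: nat pmf. has_pgf (measure_pmf q) int (\<lambda>z. 1 / poly (chebyshev_T n) (1 / z))"
proof (induction n)
  case 0
  show ?case using has_pgf_one by auto
next
  case (Suc n)
  then obtain p q :: "nat pmf"
    where p: "has_pgf (measure_pmf p) int (\<lambda>z. 1 / poly (chebyshev_T n) (1 / z))"
      and q: "has_pgf (measure_pmf q) int
        (\<lambda>z. poly (chebyshev_T n) (1 / z) / poly (chebyshev_T (Suc n)) (1 / z))"
    using has_pgf_chebyshev_ratio by blast
  have "poly (chebyshev_T n) (1 / z) \<noteq> 0" if "z \<in> {0<..1}" for z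
    using chebyshev_T_inverse_ge_1[OF that, of n] by auto
  then have "has_pgf (measure_pmf (map_pmf (\<lambda>(i, j). i + j) (pair_pmf p q))) int
      (\<lambda>z. 1 / poly (chebyshev_T (Suc n)) (1 / z))"
    using has_pgf_mult[OF p q] by (simp add: has_pgf_def)
  then show ?case by blast
qed

section \<open>The first-passage generating function\<close>

text \<open>For nonnegative coefficients the converse of Abel's theorem holds: each partial sum at \<open>1\<close>
  is a limit of partial sums at \<open>u < 1\<close> and hence bounded by \<open>l\<close>, while every value
  \<open>H u\<close> is at most the full sum. It supplies the total mass of a law that is known only through
  its power series inside the unit interval.\<close>

lemma sums_of_left_limit_at_1:
  fixes c :: "nat \<Rightarrow> real"
  assumes nonneg: "\<And>k. 0 \<le> c k"
    and s: "\<And>u. u \<in> {0<..<1} \<Longrightarrow> (\<lambda>k. c k * u ^ k) sums H u"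
    and lim: "(H \<longlongrightarrow> l) (at_left 1)"
  shows "c sums l"
proof -
  have ev: "\<forall>\<^sub>F u in at_left (1::real). u \<in> {0<..<1}"
    by (rule eventually_at_left_real) simp
  have partial: "(\<Sum>k<N. c k) \<le> l" for N
  proof (rule tendsto_le[OF _ lim])
    show "((\<lambda>u. \<Sum>k<N. c k * u ^ k) \<longlongrightarrow> (\<Sum>k<N. c k)) (at_left 1)"
      by (auto intro!: tendsto_eq_intros)
    show "\<forall>\<^sub>F u in at_left 1. (\<Sum>k<N. c k * u ^ k) \<le> H u"
      using ev
    proof eventually_elim
      case (elim u)
      then show ?case
        using sum_le_suminf[OF sums_summable[OF s[OF elim]], of "{..<N}"] nonneg
          sums_unique[OF s[OF elim]] by auto
    qed
  qed simp
  then have sm: "summable c"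
    using nonneg by (intro summableI_nonneg_bounded) auto
  have "l \<le> suminf c"
  proof (rule tendsto_upperbound[OF lim])
    show "\<forall>\<^sub>F u in at_left 1. H u \<le> suminf c"
      using ev
    proof eventually_elim
      case (elim u)
      have "c k * u ^ k \<le> c k" for k
        using nonneg[of k] elim by (auto intro!: mult_left_le power_le_one)
      then show ?case
        using sums_le[OF _ s[OF elim] summable_sums[OF sm]] by auto
    qed
  qed simp
  moreover have "suminf c \<le> l"
    using sm partial by (rule suminf_le_const)
  ultimately show ?thesis
    using summable_sums[OF sm] by simp
qed

lemma has_pgf_of_power_series:
  fixes c :: "nat \<Rightarrow> real"
  assumes nonneg: "\<And>k. 0 \<le> c k"
    and s: "\<And>u. u \<in> {0<..1} \<Longrightarrow> (\<lambda>k. c k * u ^ k) sums H u"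
    and one: "H 1 = 1"
  shows "\<exists>p :: nat pmf. has_pgf (measure_pmf p) int H"
proof -
  have c1: "c sums 1" using s[of 1] one by simp
  have "(\<integral>\<^sup>+k. ennreal (c k) \<partial>count_space UNIV) = 1"
    using suminf_ennreal_eq[OF nonneg c1] by (simp add: nn_integral_count_space_nat)
  then have p: "pmf (embed_pmf c) k = c k" for k
    using nonneg by (intro pmf_embed_pmf) auto
  have "has_pgf (measure_pmf (embed_pmf c)) int H"
    unfolding has_pgf_pmf_iff
  proof (intro ballI conjI)
    fix z :: real assume z: "z \<in> {0<..1}"
    show "0 \<le> H z"
      using s[OF z] nonneg z by (intro sums_le[OF _ sums_zero s[OF z]]) auto
    show "(\<integral>\<^sup>+k. ennreal (z ^ k) \<partial>measure_pmf (embed_pmf c)) = ennreal (H z)"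
      using s[OF z] z by (intro nn_integral_pmf_sums) (auto simp: p)
  qed
  then show ?thesis by blast
qed

text \<open>Beyond the constant term all coefficients of \<open>sqrt (1 - u)\<close> are negative; their absolute
  values are Catalan numbers divided by powers of two.\<close>

lemma sqrt_series_coeff:
  "(- 1) ^ k * ((1 / 2 :: real) gchoose Suc k) = pochhammer (1 / 2) k / (2 * fact (Suc k))"
  using gbinomial_rec[of "- (1 / 2) :: real" k]
  by (simp add: gbinomial_pochhammer[of "- (1 / 2)"] field_simps del: of_nat_Suc flip: power_mult_distrib)

lemma has_pgf_sqrt_quotient:
  "\<exists>p :: nat pmf. has_pgf (measure_pmf p) int (\<lambda>u. (1 - sqrt (1 - u)) / u)"
proof -
  define c :: "nat \<Rightarrow> real" where "c = (\<lambda>k. (- 1) ^ k * ((1 / 2) gchoose Suc k))"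
  have nonneg: "0 \<le> c k" for k
    unfolding c_def sqrt_series_coeff by (intro divide_nonneg_nonneg pochhammer_nonneg) auto
  \<comment> \<open>Inside the unit interval this is the binomial series of \<open>sqrt (1 - u)\<close> without its
    constant term, divided by \<open>- u\<close>.\<close>
  have inner: "(\<lambda>k. c k * u ^ k) sums ((1 - sqrt (1 - u)) / u)" if u: "u \<in> {0<..<1}" for u
  proof -
    have "(\<lambda>n. ((1 / 2) gchoose n) * (- u) ^ n) sums sqrt (1 - u)"
      using gen_binomial_real[of "- u" "1 / 2"] u by (simp add: powr_half_sqrt)
    then have "(\<lambda>n. ((1 / 2) gchoose Suc n) * (- u) ^ Suc n) sums (sqrt (1 - u) - 1)"
      by (subst sums_Suc_iff) simp
    then have "(\<lambda>n. (- 1 / u) * (((1 / 2) gchoose Suc n) * (- u) ^ Suc n))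
        sums ((- 1 / u) * (sqrt (1 - u) - 1))"
      by (rule sums_mult)
    moreover have "(- 1 / u) * (((1 / 2) gchoose Suc n) * (- u) ^ Suc n) = c n * u ^ n" for n
      using u by (simp add: c_def power_minus[of u])
    moreover have "(- 1 / u) * (sqrt (1 - u) - 1) = (1 - sqrt (1 - u)) / u"
      using u by (simp add: field_simps)
    ultimately show ?thesis by simp
  qed
  have "((\<lambda>u::real. (1 - sqrt (1 - u)) / u) \<longlongrightarrow> 1) (at_left 1)"
    by (auto intro!: tendsto_eq_intros)
  from sums_of_left_limit_at_1[OF nonneg inner this] have "c sums 1" .
  then have "(\<lambda>k. c k * u ^ k) sums ((1 - sqrt (1 - u)) / u)" if "u \<in> {0<..1}" for u
    using inner[of u] that by (cases "u = 1") auto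
  then show ?thesis
    using nonneg by (intro has_pgf_of_power_series[of c]) auto
qed

text \<open>This is the generating function of the time at which a simple symmetric random walk started at
  \<open>0\<close> first hits \<open>1\<close>.\<close>

definition first_passage_pgf :: "real \<Rightarrow> real" where
  "first_passage_pgf z = (1 - sqrt (1 - z\<^sup>2)) / z"

text \<open>With \<open>u = z\<^sup>2\<close> the function is \<open>z\<close> times the series above, so the law is that of
  \<open>2 * K + 1\<close>, where \<open>K\<close> has generating function \<open>(1 - sqrt (1 - u)) / u\<close>. Writing it as an image under \<open>Suc\<close> records that the values are positive.\<close>

lemma has_pgf_first_passage:
  "\<exists>p :: nat pmf. has_pgf (measure_pmf (map_pmf Suc p)) int first_passage_pgf"
proof -
  obtain p :: "nat pmf" where p: "has_pgf (measure_pmf p) int (\<lambda>u. (1 - sqrt (1 - u)) / u)"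
    using has_pgf_sqrt_quotient by blast
  have "has_pgf (measure_pmf (map_pmf Suc (map_pmf ((*) 2) p))) int first_passage_pgf"
    unfolding has_pgf_pmf_iff first_passage_pgf_def
  proof (intro ballI conjI)
    fix z :: real assume z: "z \<in> {0<..1}"
    then have z2: "z\<^sup>2 \<in> {0<..1}" by (auto intro: power_le_one)
    with z show "0 \<le> (1 - sqrt (1 - z\<^sup>2)) / z" by (intro divide_nonneg_nonneg) auto
    have "(\<integral>\<^sup>+k. ennreal (z ^ k) \<partial>measure_pmf (map_pmf Suc (map_pmf ((*) 2) p)))
        = (\<integral>\<^sup>+k. ennreal z * ennreal ((z\<^sup>2) ^ k) \<partial>measure_pmf p)"
      using z by (simp add: power_mult ennreal_mult)
    also have "\<dots> = ennreal z * ennreal ((1 - sqrt (1 - z\<^sup>2)) / z\<^sup>2)"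
      using p z2 by (simp add: nn_integral_cmult has_pgf_pmf_iff)
    also have "\<dots> = ennreal ((1 - sqrt (1 - z\<^sup>2)) / z)"
      using z z2 by (subst ennreal_mult[symmetric]) (auto simp: power2_eq_square)
    finally show "(\<integral>\<^sup>+k. ennreal (z ^ k) \<partial>measure_pmf (map_pmf Suc (map_pmf ((*) 2) p)))
        = ennreal ((1 - sqrt (1 - z\<^sup>2)) / z)" .
  qed
  then show ?thesis by blast
qed

section \<open>A bounded generating function determines the law\<close>

text \<open>Only positive arguments are available, so the coefficients are read off one at a time as
  limits at \<open>0\<close> from the right.\<close>

lemma power_series_zero_unique:
  fixes d :: "nat \<Rightarrow> real"
  assumes zero: "\<And>x. x \<in> {0<..<1} \<Longrightarrow> (\<lambda>k. d k * x ^ k) sums 0"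
  shows "d k = 0"
proof (induction k rule: less_induct)
  case (less k)
  have shift: "(\<lambda>j. d (j + k) * x ^ j) sums 0" if x: "x \<in> {0<..<1}" for x
  proof -
    have "(\<lambda>j. d (j + k) * x ^ (j + k)) sums 0"
      using zero[OF x] less.IH by (subst sums_iff_shift) simp
    then have "(\<lambda>j. d (j + k) * x ^ (j + k) / x ^ k) sums (0 / x ^ k)"
      by (rule sums_divide)
    then show ?thesis using x by (simp add: power_add)
  qed
  have "(\<lambda>j. d (j + k) * x ^ j) sums (\<Sum>j. d (j + k) * x ^ j)" if "norm x < 1 / 2" for x
    using powser_inside[OF sums_summable[OF shift[of "1 / 2"]], of x] that
    by (intro summable_sums) auto
  then have "((\<lambda>x. \<Sum>j. d (j + k) * x ^ j) \<longlongrightarrow> d (0 + k)) (at 0)"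
    by (rule powser_limit_0[rotated, where s = "1 / 2"]) auto
  then have "((\<lambda>x. \<Sum>j. d (j + k) * x ^ j) \<longlongrightarrow> d (0 + k)) (at_right 0)"
    by (rule tendsto_within_subset) auto
  moreover have "\<forall>\<^sub>F x in at_right (0::real). x \<in> {0<..<1}"
    by (rule eventually_at_right_real) simp
  then have "((\<lambda>x. \<Sum>j. d (j + k) * x ^ j) \<longlongrightarrow> 0) (at_right 0)"
    by (intro tendsto_eventually) (auto elim!: eventually_mono simp: sums_unique[OF shift, symmetric])
  ultimately show ?case
    using tendsto_unique[of "at_right (0::real)"] by fastforce
qed

text \<open>A generating function on \<open>{0<..1}\<close> may belong to a variable with negative values, but then it
  blows up near \<open>0\<close>: on the event \<open>X < 0\<close> one has \<open>z powi X \<ge> 1 / z\<close>, so Markov's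
  inequality bounds the probability of this event by \<open>z * G z\<close>.\<close>

lemma has_pgf_le_1_imp_nonneg:
  assumes pgf: "has_pgf M X G" and le: "\<And>z. z \<in> {0<..1} \<Longrightarrow> G z \<le> 1"
  shows "AE \<omega> in M. 0 \<le> X \<omega>"
proof -
  from pgf interpret prob_space M by (simp add: has_pgf_def)
  have [measurable]: "X \<in> measurable M (count_space UNIV)" using pgf by (simp add: has_pgf_def)
  let ?A = "{\<omega>\<in>space M. X \<omega> < 0}"
  have "prob ?A \<le> z" if z: "z \<in> {0<..1}" for z
  proof -
    have "ennreal (1 / z) * emeasure M ?A = (\<integral>\<^sup>+\<omega>. ennreal (1 / z) * indicator ?A \<omega> \<partial>M)"
      by (simp add: nn_integral_cmult_indicator)
    also have "\<dots> \<le> (\<integral>\<^sup>+\<omega>. ennreal (z powi X \<omega>) \<partial>M)"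
    proof (intro nn_integral_mono)
      fix \<omega>
      have "1 / z \<le> z powi X \<omega>" if "X \<omega> < 0"
        using power_int_decreasing[of "X \<omega>" "-1" z] that z by (simp add: power_int_minus divide_inverse)
      then show "ennreal (1 / z) * indicator ?A \<omega> \<le> ennreal (z powi X \<omega>)"
        by (auto simp: indicator_def intro!: ennreal_leI)
    qed
    also have "\<dots> \<le> 1"
      using pgf le[OF z] z by (auto simp: has_pgf_iff_nn_integral)
    finally have "ennreal (1 / z * prob ?A) \<le> ennreal 1"
      using z by (subst ennreal_mult) (auto simp: emeasure_eq_measure)
    then have "1 / z * prob ?A \<le> 1"
      by (simp only: ennreal_le_iff zero_le_one)
    then show ?thesis using z by (simp add: field_simps)
  qed
  note Markov = this
  have "prob ?A \<le> 0"
    using Markov[of "prob ?A / 2"] prob_le_1[of ?A] by (cases "prob ?A \<le> 0") auto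
  then have "prob ?A = 0" by (simp add: measure_le_0_iff)
  then show ?thesis
    by (intro AE_I[where N = ?A]) (auto simp: emeasure_eq_measure)
qed

lemma has_pgf_sums:
  assumes pgf: "has_pgf M X G" and nonneg: "AE \<omega> in M. 0 \<le> X \<omega>" and z: "z \<in> {0<..1}"
  shows "(\<lambda>k. measure M {\<omega>\<in>space M. X \<omega> = int k} * z ^ k) sums G z"
proof -
  from pgf interpret prob_space M by (simp add: has_pgf_def)
  have [measurable]: "X \<in> measurable M (count_space UNIV)" using pgf by (simp add: has_pgf_def)
  let ?A = "\<lambda>k. {\<omega>\<in>space M. X \<omega> = int k}"
  have "ennreal (G z) = (\<integral>\<^sup>+\<omega>. ennreal (z powi X \<omega>) \<partial>M)"
    using pgf z by (simp add: has_pgf_iff_nn_integral)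
  also have "\<dots> = (\<integral>\<^sup>+\<omega>. (\<Sum>k. ennreal (z ^ k) * indicator (?A k) \<omega>) \<partial>M)"
  proof (rule nn_integral_cong_AE)
    show "AE \<omega> in M. ennreal (z powi X \<omega>) = (\<Sum>k. ennreal (z ^ k) * indicator (?A k) \<omega>)"
      using nonneg AE_space
    proof eventually_elim
      case (elim \<omega>)
      have "(\<Sum>k. ennreal (z ^ k) * indicator (?A k) \<omega>)
          = (\<Sum>k\<in>{nat (X \<omega>)}. ennreal (z ^ k) * indicator (?A k) \<omega>)"
        using elim by (intro suminf_finite) (auto simp: indicator_def)
      then show ?case using elim by (simp add: power_int_def)
    qed
  qed
  also have "\<dots> = (\<Sum>k. ennreal (prob (?A k) * z ^ k))"
    using z by (simp add: nn_integral_suminf nn_integral_cmult_indicator emeasure_eq_measure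
        ennreal_mult mult.commute)
  finally have e: "(\<Sum>k. ennreal (prob (?A k) * z ^ k)) = ennreal (G z)" by simp
  have pos: "0 \<le> prob (?A k) * z ^ k" for k using z by simp
  have sm: "summable (\<lambda>k. prob (?A k) * z ^ k)"
    using e by (intro summable_suminf_not_top pos) simp
  have "ennreal (\<Sum>k. prob (?A k) * z ^ k) = ennreal (G z)"
    using e suminf_ennreal2[OF pos sm] by simp
  then have "(\<Sum>k. prob (?A k) * z ^ k) = G z"
    using pgf z suminf_nonneg[OF sm pos] by (simp add: has_pgf_iff_nn_integral)
  then show ?thesis using summable_sums[OF sm] by simp
qed

text \<open>Boundedness makes both variables nonnegative, so that the two generating functions are power
  series in \<open>z\<close> with the point masses as coefficients. Bounding \<open>G\<close> instead of assuming
  nonnegative variables spares the check that the random sums compared below are nonnegative.\<close>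

lemma distr_eq_of_has_pgf:
  assumes M: "has_pgf M X G" and N: "has_pgf N Y G" and le: "\<And>z. z \<in> {0<..1} \<Longrightarrow> G z \<le> 1"
  shows "distr M (count_space UNIV) X = distr N (count_space UNIV) Y"
proof -
  interpret M: prob_space M using M by (simp add: has_pgf_def)
  interpret N: prob_space N using N by (simp add: has_pgf_def)
  have X[measurable]: "X \<in> measurable M (count_space UNIV)" using M by (simp add: has_pgf_def)
  have Y[measurable]: "Y \<in> measurable N (count_space UNIV)" using N by (simp add: has_pgf_def)
  have Xn: "AE \<omega> in M. 0 \<le> X \<omega>" using has_pgf_le_1_imp_nonneg[OF M le] .
  have Yn: "AE \<omega> in N. 0 \<le> Y \<omega>" using has_pgf_le_1_imp_nonneg[OF N le] .
  have "(\<lambda>k. (M.prob {\<omega>\<in>space M. X \<omega> = int k} - N.prob {\<omega>\<in>space N. Y \<omega> = int k}) * z ^ k) sums 0"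
    if "z \<in> {0<..<1}" for z
    using sums_diff[OF has_pgf_sums[OF M Xn, of z] has_pgf_sums[OF N Yn, of z]] that
    by (simp add: left_diff_distrib)
  from power_series_zero_unique[OF this]
  have eq: "M.prob {\<omega>\<in>space M. X \<omega> = int k} = N.prob {\<omega>\<in>space N. Y \<omega> = int k}" for k
    by simp
  have "emeasure M {\<omega>\<in>space M. X \<omega> = i} = emeasure N {\<omega>\<in>space N. Y \<omega> = i}" for i
  proof (cases "0 \<le> i")
    case True
    then show ?thesis using eq[of "nat i"] by (simp add: M.emeasure_eq_measure N.emeasure_eq_measure)
  next
    case False
    have "AE \<omega> in M. X \<omega> \<noteq> i" using Xn by eventually_elim (use False in auto)
    moreover have "AE \<omega> in N. Y \<omega> \<noteq> i" using Yn by eventually_elim (use False in auto)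
    ultimately show ?thesis by (simp add: AE_iff_measurable[OF _ refl])
  qed
  then show ?thesis
    by (intro measure_eqI_countable[where A = UNIV])
       (auto simp: emeasure_distr vimage_def Int_def conj_commute)
qed

section \<open>Sums of independent variables on product measures\<close>

lemma measurable_sum_count_space:
  fixes f :: "'i \<Rightarrow> 'a \<Rightarrow> 'b :: {countable, comm_monoid_add}"
  assumes "finite I" and "\<And>i. i \<in> I \<Longrightarrow> f i \<in> measurable M (count_space UNIV)"
  shows "(\<lambda>x. \<Sum>i\<in>I. f i x) \<in> measurable M (count_space UNIV)"
  using assms
proof (induction I rule: finite_induct)
  case (insert i I)
  have "(\<lambda>x. f i x + (\<Sum>i\<in>I. f i x)) \<in> measurable M (count_space UNIV)"
  proof (rule measurable_compose_countable[where f = "\<lambda>a x. a + (\<Sum>i\<in>I. f i x)" and g = "f i"])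
    show "(\<lambda>x. a + (\<Sum>i\<in>I. f i x)) \<in> measurable M (count_space UNIV)" for a
      by (rule measurable_compose[of _ M "count_space UNIV"]) (use insert in auto)
  qed (use insert in auto)
  then show ?case using insert by simp
qed simp

lemma has_pgf_iid_sum:
  fixes L :: "int measure"
  assumes L: "has_pgf L (\<lambda>i. i) G"
  shows "has_pgf (\<Pi>\<^sub>M i\<in>{1..n::nat}. L) (\<lambda>x. \<Sum>i=1..n. x i) (\<lambda>z. G z ^ n)"
  unfolding has_pgf_iff_nn_integral
proof (intro conjI ballI)
  interpret prob_space L using L by (simp add: has_pgf_def)
  interpret product_prob_space "\<lambda>_. L" "{1..n}" by standard
  have id: "(\<lambda>i. i) \<in> measurable L (count_space UNIV)" using L by (simp add: has_pgf_def)
  show "prob_space (\<Pi>\<^sub>M i\<in>{1..n}. L)" by (rule P.prob_space_axioms)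
  show m: "(\<lambda>x. \<Sum>i=1..n. x i) \<in> measurable (\<Pi>\<^sub>M i\<in>{1..n}. L) (count_space UNIV)"
    by (intro measurable_sum_count_space measurable_compose[OF _ id] measurable_component_singleton) auto
  fix z :: real assume z: "z \<in> {0<..1}"
  have G: "0 \<le> G z" "(\<integral>\<^sup>+i. ennreal (z powi i) \<partial>L) = ennreal (G z)"
    using L z by (auto simp: has_pgf_iff_nn_integral)
  then show "0 \<le> G z ^ n" by simp
  have "z powi (\<Sum>i\<in>I. x i) = (\<Prod>i\<in>I. z powi x i)" for x :: "nat \<Rightarrow> int" and I
    using z by (induction I rule: infinite_finite_induct) (auto simp: power_int_add)
  then have "(\<integral>\<^sup>+x. ennreal (z powi (\<Sum>i=1..n. x i)) \<partial>(\<Pi>\<^sub>M i\<in>{1..n}. L))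
      = (\<integral>\<^sup>+x. (\<Prod>i\<in>{1..n}. ennreal (z powi x i)) \<partial>(\<Pi>\<^sub>M i\<in>{1..n}. L))"
    using z by (simp add: prod_ennreal)
  also have "\<dots> = (\<Prod>i\<in>{1..n}. \<integral>\<^sup>+i. ennreal (z powi i) \<partial>L)"
    by (rule product_nn_integral_prod) (auto intro: measurable_compose[OF id])
  finally show "(\<integral>\<^sup>+x. ennreal (z powi (\<Sum>i=1..n. x i)) \<partial>(\<Pi>\<^sub>M i\<in>{1..n}. L)) = ennreal (G z ^ n)"
    using G by (simp add: ennreal_power)
qed

text \<open>Conditionally on \<open>x\<close> the sum has generating function \<open>Q z ^ nat x\<close>, and integrating over
  \<open>x\<close> evaluates \<open>G\<close> at \<open>Q z\<close>. Nonnegativity of \<open>x\<close> is what makes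
  \<open>nat x\<close> the true exponent; the range condition on \<open>Q\<close> keeps \<open>Q z\<close> in the domain of
  \<open>G\<close>.\<close>

lemma has_pgf_random_sum:
  fixes L :: "int measure" and q :: "nat pmf"
  assumes L: "has_pgf L (\<lambda>i. i) G" and sets: "sets L = UNIV" and nonneg: "AE i in L. 0 \<le> i"
    and q: "has_pgf (measure_pmf q) int Q" and Q: "\<And>z. z \<in> {0<..1} \<Longrightarrow> Q z \<in> {0<..1}"
  shows "has_pgf (L \<Otimes>\<^sub>M (\<Pi>\<^sub>M j\<in>(UNIV :: nat set). measure_pmf q))
           (\<lambda>(x, e). int (\<Sum>j=1..nat x. e j)) (\<lambda>z. G (Q z))"
  unfolding has_pgf_iff_nn_integral
proof (intro conjI ballI)
  let ?\<Pi> = "\<Pi>\<^sub>M j\<in>(UNIV :: nat set). measure_pmf q"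
  interpret L: prob_space L using L by (simp add: has_pgf_def)
  interpret E: product_prob_space "\<lambda>_. measure_pmf q" "UNIV :: nat set" by standard
  interpret E: prob_space ?\<Pi> by (rule E.P.prob_space_axioms)
  show "prob_space (L \<Otimes>\<^sub>M ?\<Pi>)" by (intro prob_space_pair L.prob_space_axioms E.prob_space_axioms)
  have sum_meas: "(\<lambda>e. \<Sum>j\<in>J. e j) \<in> measurable ?\<Pi> (count_space UNIV)" if "finite J" for J
    using that by (intro measurable_sum_count_space measurable_compose[OF measurable_component_singleton]) auto
  have "(\<lambda>(x, e). int (\<Sum>j=1..nat x. e j)) \<in> measurable (count_space UNIV \<Otimes>\<^sub>M ?\<Pi>) (count_space UNIV)"
    by (rule measurable_pair_measure_countable1)
       (auto intro!: measurable_compose[OF sum_meas] simp del: of_nat_sum)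
  moreover have "sets (L \<Otimes>\<^sub>M ?\<Pi>) = sets (count_space UNIV \<Otimes>\<^sub>M ?\<Pi>)"
    using sets by (intro sets_pair_measure_cong) auto
  ultimately show m: "(\<lambda>(x, e). int (\<Sum>j=1..nat x. e j)) \<in> measurable (L \<Otimes>\<^sub>M ?\<Pi>) (count_space UNIV)"
    by (subst measurable_cong_sets[OF _ refl])
  fix z :: real assume z: "z \<in> {0<..1}"
  show "0 \<le> G (Q z)" using L Q[OF z] by (auto simp: has_pgf_iff_nn_integral)
  \<comment> \<open>For fixed \<open>x\<close> only finitely many coordinates of the infinite product matter, so the
    integral factorises after restriction to them.\<close>
  have inner: "(\<integral>\<^sup>+e. ennreal (z ^ (\<Sum>j\<in>J. e j)) \<partial>?\<Pi>) = ennreal (Q z ^ card J)" if J: "finite J" for J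
  proof -
    have "(\<integral>\<^sup>+e. ennreal (z ^ (\<Sum>j\<in>J. e j)) \<partial>?\<Pi>)
        = (\<integral>\<^sup>+e. (\<Prod>j\<in>J. ennreal (z ^ e j)) \<partial>?\<Pi>)"
      using z by (simp add: prod_ennreal power_sum)
    also have "\<dots> = (\<integral>\<^sup>+e. (\<Prod>j\<in>J. ennreal (z ^ restrict e J j)) \<partial>?\<Pi>)"
      by simp
    also have "\<dots> = (\<integral>\<^sup>+e. (\<Prod>j\<in>J. ennreal (z ^ e j))
        \<partial>distr ?\<Pi> (\<Pi>\<^sub>M j\<in>J. measure_pmf q) (\<lambda>e. restrict e J))"
      by (rule nn_integral_distr[symmetric, OF measurable_restrict_subset])
         (auto intro!: borel_measurable_prod_ennreal
           measurable_compose[OF measurable_component_singleton])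
    also have "\<dots> = (\<integral>\<^sup>+e. (\<Prod>j\<in>J. ennreal (z ^ e j)) \<partial>(\<Pi>\<^sub>M j\<in>J. measure_pmf q))"
      using J by (simp add: E.distr_PiM_restrict_finite)
    also have "\<dots> = (\<Prod>j\<in>J. \<integral>\<^sup>+k. ennreal (z ^ k) \<partial>measure_pmf q)"
      using J by (intro E.product_nn_integral_prod) auto
    also have "\<dots> = ennreal (Q z ^ card J)"
      using q z by (simp add: has_pgf_pmf_iff ennreal_power)
    finally show ?thesis .
  qed
  have mz: "(\<lambda>w. ennreal (z powi (case w of (x, e) \<Rightarrow> int (\<Sum>j=1..nat x. e j))))
      \<in> borel_measurable (L \<Otimes>\<^sub>M ?\<Pi>)"
    by (rule measurable_compose[OF m]) simp
  have "(\<integral>\<^sup>+w. ennreal (z powi (case w of (x, e) \<Rightarrow> int (\<Sum>j=1..nat x. e j))) \<partial>(L \<Otimes>\<^sub>M ?\<Pi>))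
      = (\<integral>\<^sup>+x. \<integral>\<^sup>+e. ennreal (z powi int (\<Sum>j=1..nat x. e j)) \<partial>?\<Pi> \<partial>L)"
    by (subst E.nn_integral_fst[symmetric, OF mz]) (simp del: of_nat_sum)
  also have "\<dots> = (\<integral>\<^sup>+x. ennreal (Q z ^ nat x) \<partial>L)"
    by (simp add: inner del: of_nat_sum)
  also have "\<dots> = (\<integral>\<^sup>+x. ennreal (Q z powi x) \<partial>L)"
    by (rule nn_integral_cong_AE) (use nonneg in \<open>eventually_elim; simp add: power_int_def\<close>)
  also have "\<dots> = ennreal (G (Q z))"
    using L Q[OF z] by (simp add: has_pgf_iff_nn_integral)
  finally show "(\<integral>\<^sup>+w. ennreal (z powi (case w of (x, e) \<Rightarrow> int (\<Sum>j=1..nat x. e j))) \<partial>(L \<Otimes>\<^sub>M ?\<Pi>))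
      = ennreal (G (Q z))" .
qed

lemma has_pgf_distr:
  assumes "has_pgf M X G"
  shows "has_pgf (distr M (count_space UNIV) X) (\<lambda>i. i) G"
proof -
  have "X \<in> measurable M (count_space UNIV)" using assms by (simp add: has_pgf_def)
  then show ?thesis
    using assms by (simp add: has_pgf_iff_nn_integral nn_integral_distr prob_space.prob_space_distr)
qed

section \<open>The Chebyshev functional equation and stability\<close>

lemma first_passage_pgf_sech:
  fixes t :: real
  assumes "0 \<le> t"
  shows "first_passage_pgf (1 / cosh t) = exp (- t)"
proof -
  have c: "cosh t > 0" by (rule cosh_real_pos)
  have "1 - (1 / cosh t)\<^sup>2 = (sinh t / cosh t)\<^sup>2"
    using c by (simp add: power_divide sinh_square_eq divide_simps)
  then have "sqrt (1 - (1 / cosh t)\<^sup>2) = sinh t / cosh t"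
    using assms c by simp
  then show ?thesis
    using c unfolding first_passage_pgf_def
    by (simp add: divide_simps) (simp add: cosh_minus_sinh algebra_simps)
qed

lemma first_passage_pgf_bounds:
  assumes "z \<in> {0<..1}"
  shows "0 \<le> first_passage_pgf z" and "first_passage_pgf z \<le> 1"
proof -
  obtain t where t: "0 \<le> t" "z = 1 / cosh t" using unit_interval_sech[OF assms] .
  then have "first_passage_pgf z = exp (- t)" by (simp add: first_passage_pgf_sech)
  then show "0 \<le> first_passage_pgf z" and "first_passage_pgf z \<le> 1" using t(1) by simp_all
qed

text \<open>In the coordinate \<open>t\<close> the Chebyshev operator is multiplication by \<open>n\<close>, and
  multiplying \<open>t\<close> by \<open>n\<close> raises \<open>exp (- t)\<close> to the \<open>n\<close>-th power.\<close>

lemma first_passage_pgf_chebyshev: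
  assumes "z \<in> {0<..1}"
  shows "first_passage_pgf (1 / poly (chebyshev_T n) (1 / z)) = first_passage_pgf z ^ n"
proof -
  obtain t where t: "0 \<le> t" "z = 1 / cosh t" using unit_interval_sech[OF assms] .
  have "first_passage_pgf (1 / poly (chebyshev_T n) (1 / z)) = first_passage_pgf (1 / cosh (real n * t))"
    by (simp add: t chebyshev_T_cosh)
  also have "\<dots> = exp (- t) ^ n"
    using t by (simp add: first_passage_pgf_sech exp_of_nat_mult[symmetric])
  finally show ?thesis
    using t by (simp add: first_passage_pgf_sech)
qed

theorem theorem2p18:
  fixes m :: nat and P :: "real \<Rightarrow> real"
  assumes "m \<ge> 1"
  defines "P \<equiv> \<lambda>z. ((1 - sqrt (1 - z\<^sup>2)) / z) ^ m"
  shows "(\<exists>(N :: nat measure) Y. (\<forall>\<omega>\<in>space N. 1 \<le> Y \<omega>) \<and> has_pgf N Y P) \<and>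
    (\<forall>(M :: 'a measure) X. has_pgf M X P \<longrightarrow>
       (\<exists>p E. chebyshev_portlying p E \<and> positive_discrete_stable2 p E M X))"
proof -
  have P: "P = (\<lambda>z. first_passage_pgf z ^ m)"
    by (simp add: P_def first_passage_pgf_def)
  show ?thesis
  proof (intro conjI allI impI)
    obtain p :: "nat pmf" where p: "has_pgf (measure_pmf (map_pmf Suc p)) int first_passage_pgf"
      using has_pgf_first_passage by blast
    \<comment> \<open>One of the \<open>m\<close> factors is split off, so that its \<open>Suc\<close> can be moved outermost; this makes the variable positive at every point, as opposed to almost surely.\<close>
    obtain q :: "nat pmf" where q: "has_pgf (measure_pmf q) int (\<lambda>z. first_passage_pgf z ^ (m - 1))"
      using has_pgf_power[OF p] by blast
    have "has_pgf (measure_pmf (map_pmf (\<lambda>(i, j). i + j) (pair_pmf (map_pmf Suc p) q))) int P"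
      using has_pgf_mult[OF p q] assms(1) by (simp add: P power_eq_if[of _ m])
    moreover have "map_pmf (\<lambda>(i, j). i + j) (pair_pmf (map_pmf Suc p) q)
        = map_pmf Suc (map_pmf (\<lambda>(i, j). i + j) (pair_pmf p q))"
      by (simp add: pair_map_pmf1 map_pmf_comp case_prod_unfold)
    ultimately have "has_pgf (measure_pmf (map_pmf (\<lambda>(i, j). i + j) (pair_pmf p q))) (\<lambda>k. int (Suc k)) P"
      by (simp add: has_pgf_iff_nn_integral measure_pmf.prob_space_axioms del: of_nat_Suc)
    then show "\<exists>(N :: nat measure) Y. (\<forall>\<omega>\<in>space N. 1 \<le> Y \<omega>) \<and> has_pgf N Y P"
      by (intro exI conjI) auto
  next
    fix M :: "'a measure" and X assume X: "has_pgf M X P"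
    obtain e :: "nat \<Rightarrow> nat pmf"
      where e: "has_pgf (measure_pmf (e n)) int (\<lambda>z. 1 / poly (chebyshev_T n) (1 / z))" for n
      using has_pgf_chebyshev by metis
    \<comment> \<open>The parameter \<open>p\<^sub>n = n\<close> is a real number, whereas the family above is indexed by
      naturals; the floor recovers the index.\<close>
    let ?E = "\<lambda>r. e (nat \<lfloor>r\<rfloor>)"
    let ?L = "distr M (count_space UNIV) X"
    have L: "has_pgf ?L (\<lambda>i. i) P" using X by (rule has_pgf_distr)
    have P_le: "P z \<le> 1" if "z \<in> {0<..1}" for z
      using first_passage_pgf_bounds[OF that] by (simp add: P power_le_one)
    have P_nonneg: "0 \<le> P z" if "z \<in> {0<..1}" for z
      using first_passage_pgf_bounds(1)[OF that] by (simp add: P)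
    have L_nonneg: "AE i in ?L. 0 \<le> i" using has_pgf_le_1_imp_nonneg[OF L P_le] .
    have Q: "1 / poly (chebyshev_T n) (1 / z) \<in> {0<..1}" if "z \<in> {0<..1}" for n and z :: real
      using chebyshev_T_inverse_ge_1[OF that, of n] by auto
    have "distr (?L \<Otimes>\<^sub>M (\<Pi>\<^sub>M j\<in>(UNIV :: nat set). measure_pmf (e n))) (count_space UNIV)
            (\<lambda>(x, e). int (\<Sum>j=1..nat x. e j)) =
          distr (\<Pi>\<^sub>M i\<in>{1..n}. ?L) (count_space UNIV) (\<lambda>x. \<Sum>i=1..n. x i)" for n
    proof (rule distr_eq_of_has_pgf)
      show "has_pgf (\<Pi>\<^sub>M i\<in>{1..n}. ?L) (\<lambda>x. \<Sum>i=1..n. x i) (\<lambda>z. P z ^ n)"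
        by (rule has_pgf_iid_sum[OF L])
      have "has_pgf (?L \<Otimes>\<^sub>M (\<Pi>\<^sub>M j\<in>(UNIV :: nat set). measure_pmf (e n)))
          (\<lambda>(x, e). int (\<Sum>j=1..nat x. e j)) (\<lambda>z. P (1 / poly (chebyshev_T n) (1 / z)))"
        by (rule has_pgf_random_sum[OF L _ L_nonneg e Q]) auto
      moreover have "P (1 / poly (chebyshev_T n) (1 / z)) = P z ^ n" if "z \<in> {0<..1}" for z
        using first_passage_pgf_chebyshev[OF that, of n]
        by (simp add: P mult.commute flip: power_mult)
      ultimately show "has_pgf (?L \<Otimes>\<^sub>M (\<Pi>\<^sub>M j\<in>(UNIV :: nat set). measure_pmf (e n)))
          (\<lambda>(x, e). int (\<Sum>j=1..nat x. e j)) (\<lambda>z. P z ^ n)"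
        by (simp add: has_pgf_def)
      show "P z ^ n \<le> 1" if "z \<in> {0<..1}" for z
        using P_le[OF that] P_nonneg[OF that] by (rule power_le_one[rotated])
    qed
    then have "positive_discrete_stable2 real ?E M X"
      using X has_pgf_le_1_imp_nonneg[OF X P_le]
      by (simp add: positive_discrete_stable2_def has_pgf_def Let_def)
    moreover have "chebyshev_portlying real ?E"
      using e by (simp add: chebyshev_portlying_def)
    ultimately show "\<exists>p E. chebyshev_portlying p E \<and> positive_discrete_stable2 p E M X" by blast
  qed
qed

end
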